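(* Let $Y/\mathbb{Q}$ be the smooth K3 surface in $\mathbb{P}^1\times\mathbb{P}^1\times\mathbb{P}^1$ specified in the context, let $P_0=([0:1],[0:1],[0:1])\in Y(\mathbb{Q})$, and for each permutation $(i,j,k)$ of $(1,2,3)$ let $\hat h_{E_{ijk}}$ be the canonical height with respect to $\sigma_{kji}$ defined in the context. Suppose that each of the following estimates (the computed values of $\omega^{-5}h_{E_{ijk}}(\sigma_{kji}^5P_0)$) is equal to the corresponding canonical height $\hat h_{E_{ijk}}(P_0)$ up to an absolute error of at most $0.1$; that is, \begin{align*} |\hat h_{E_{123}}(P_0)-0.4746928|&\le 0.1, & |\hat h_{E_{132}}(P_0)-1.0364196|&\le 0.1,\\ |\hat h_{E_{213}}(P_0)-1.8329585|&\le 0.1, & |\hat h_{E_{231}}(P_0)-2.1332721|&\le 0.1,\\ |\hat h_{E_{312}}(P_0)-1.8679467|&\le 0.1, & |\hat h_{E_{321}}(P_0)-1.7986781|&\le 0.1. \end{align*} Then the surface $Y$ does not admit a canonical vector height.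
   Context: **The surface.** $Y/\mathbb{Q}$ is the surface in $\mathbb{P}^1\times\mathbb{P}^1\times\mathbb{P}^1$ given by the $(2,2,2)$-form whose affine equation, in affine coordinates $x,y,z$ (corresponding to $[x:1],[y:1],[z:1]$), is $G_1x^2+G_2x+3G_3-2L_1L_2=0$, where \begin{align*} G_1 &= -y^2z^2+3y^2z+2y^2-2yz^2+3yz+3y+2z^2+2z-1,\\ G_2 &= 2y^2z^2+3y^2z+3y^2+2yz^2+2yz+3z^2+z+2,\\ G_3 &= y^2z+y^2+y+z^2+z,\\ L_1 &= yz-y-z,\\ L_2 &= yz+1. \end{align*} It is smooth, hence a K3 surface. Write $\overline{Y}=Y_{\overline{\mathbb{Q}}}$. **Divisor classes.** For $i=1,2,3$ let $\pi_i:Y\to\mathbb{P}^1$ be the projection to the $i$-th copy of $\mathbb{P}^1$ and let $D_i$ be the class of a fiber of $\pi_i$. One has $D_i^2=0$ and $D_i\cdot D_j=2$ for $i\ne j$. The Picard number of $\overline{Y}$ is $3$, so $D_1,D_2,D_3$ form a basis of $\mathrm{NS}(\overline{Y})\otimes\mathbb{R}$. **Automorphisms.** $\sigma_i$ denotes the involution of $Y$ associated to the $2$-to-$1$ projection $Y\to\mathbb{P}^1\times\mathbb{P}^1$ along the $i$-th copy of $\mathbb{P}^1$ (i.e. forgetting the $i$-th coordinate), and $\sigma_{ijk}=\sigma_i\sigma_j\sigma_k$ (composition of maps). Thus $\sigma_{kji}^*=\sigma_i^*\sigma_j^*\sigma_k^*$. **Heights.** Let $h_{D_i}(P)=h(\pi_i(P))$,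 where $h$ is the usual (absolute) logarithmic height on $\mathbb{P}^1$; for $E=\sum e_iD_i\in\mathrm{NS}(\overline{Y})\otimes\mathbb{R}$ let $h_E=\sum e_ih_{D_i}$, which is a Weil height associated to $E$. **Canonical heights.** Let $\gamma=\frac12(1+\sqrt5)$ and $\omega=\gamma^6$. For a permutation $(i,j,k)$ of $(1,2,3)$ let $$E_{ijk}=\tfrac12\gamma\,(-D_i+\gamma D_j+\gamma^2D_k),$$ which is an eigenvector of $\sigma_{kji}^*$ on $\mathrm{NS}(\overline{Y})\otimes\mathbb{R}$ with eigenvalue $\omega$. The canonical height (with respect to $\sigma_{kji}$) is $$\hat h_{E_{ijk}}(P)=\lim_{n\to\infty}\omega^{-n}h_{E_{ijk}}(\sigma_{kji}^nP).$$ **Canonical vector height.** A canonical vector height on $Y$ is a function $\hat{\mathbf h}:Y(\overline{\mathbb{Q}})\to\mathrm{NS}(\overline{Y})\otimes\mathbb{R}$ such that (1) for every $E\in\mathrm{NS}(\overline{Y})\otimes\mathbb{R}$ and every Weil height $h_E$ associated to $E$, one has $\hat{\mathbf h}(P)\cdot E=h_E(P)+O(1)$ for all $P$, where $\cdot$ is the intersection pairing and the $O(1)$ is bounded independently of $P$; and (2) $\hat{\mathbf h}(\sigma P)=\sigma_*\hat{\mathbf h}(P)$ for every automorphism $\sigma$ of $\overline{Y}$ and every $P$, where $\sigma_*=(\sigma^{-1})^*$. *)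

theory Defs
  imports "HOL-Analysis.Analysis" "HOL-Algebra.Algebraic_Closure_Type"
begin

section \<open>The projective line over the algebraic closure of the rationals\<close>

type_synonym qbar = "rat alg_closure"

definition p1_rel :: "qbar \<times> qbar \<Rightarrow> qbar \<times> qbar \<Rightarrow> bool" where
  "p1_rel p q \<longleftrightarrow> p \<noteq> (0, 0) \<and> q \<noteq> (0, 0) \<and> (\<exists>c. fst p = c * fst q \<and> snd p = c * snd q)"

lemma part_equivp_p1_rel: "part_equivp p1_rel"
proof (rule part_equivpI)
  show "\<exists>p. p1_rel p p"
    by (rule exI[of _ "(1, 1)"]) (auto simp: p1_rel_def intro: exI[of _ 1])
  show "symp p1_rel"
  proof (rule sympI)
    fix p q assume "p1_rel p q"
    then obtain c where c: "p \<noteq> (0, 0)" "q \<noteq> (0, 0)" "fst p = c * fst q" "snd p = c * snd q"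
      unfolding p1_rel_def by blast
    then have "c \<noteq> 0" by (auto simp: prod_eq_iff)
    then have "fst q = inverse c * fst p \<and> snd q = inverse c * snd p"
      using c by simp
    then show "p1_rel q p" using c unfolding p1_rel_def by blast
  qed
  show "transp p1_rel"
  proof (rule transpI)
    fix p q r assume "p1_rel p q" "p1_rel q r"
    then show "p1_rel p r" unfolding p1_rel_def by (metis mult.assoc)
  qed
qed

quotient_type p1 = "qbar \<times> qbar" / partial: p1_rel
  by (rule part_equivp_p1_rel)

text \<open>
  The point with homogeneous coordinates \<open>[x : y]\<close> is \<open>abs_p1 (x, y)\<close>; this is meaningful only
  for \<open>(x, y) \<noteq> (0, 0)\<close>.
\<close>

abbreviation hpt :: "qbar \<Rightarrow> qbar \<Rightarrow> p1" where
  "hpt x y \<equiv> abs_p1 (x, y)"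


section \<open>The absolute logarithmic height on the projective line\<close>

definition rat_scale :: "rat \<Rightarrow> qbar \<Rightarrow> qbar" where
  "rat_scale q z = to_ac q * z"

definition number_field :: "qbar set \<Rightarrow> bool" where
  "number_field K \<longleftrightarrow>
     1 \<in> K \<and> (\<forall>x\<in>K. \<forall>y\<in>K. x - y \<in> K \<and> x * y \<in> K) \<and> (\<forall>x\<in>K. inverse x \<in> K) \<and>
     (\<exists>B. finite B \<and> module.span rat_scale B = K)"

definition nf_degree :: "qbar set \<Rightarrow> nat" where
  "nf_degree K = vector_space.dim rat_scale K"

definition embeddings :: "qbar set \<Rightarrow> (qbar \<Rightarrow> complex) set" where
  "embeddings K = {\<tau> \<in> extensional K. \<tau> 1 = 1 \<and>
     (\<forall>x\<in>K. \<forall>y\<in>K. \<tau> (x + y) = \<tau> x + \<tau> y \<and> \<tau> (x * y) = \<tau> x * \<tau> y)}"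

text \<open>The finite places of \<open>K\<close>, as discrete valuations normalised to have value group \<open>\<int>\<close>.\<close>

definition finite_places :: "qbar set \<Rightarrow> (qbar \<Rightarrow> int) set" where
  "finite_places K = {v \<in> extensional (K - {0}). v ` (K - {0}) = UNIV \<and>
     (\<forall>x\<in>K - {0}. \<forall>y\<in>K - {0}. v (x * y) = v x + v y \<and>
        (x + y \<noteq> 0 \<longrightarrow> v (x + y) \<ge> min (v x) (v y)))}"

definition valuation_ring :: "qbar set \<Rightarrow> (qbar \<Rightarrow> int) \<Rightarrow> qbar set" where
  "valuation_ring K v = {x \<in> K. x = 0 \<or> v x \<ge> 0}"

definition residue_card :: "qbar set \<Rightarrow> (qbar \<Rightarrow> int) \<Rightarrow> nat" where
  "residue_card K v = card (valuation_ring K v //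
     {(x, y). x \<in> valuation_ring K v \<and> y \<in> valuation_ring K v \<and> (x = y \<or> v (x - y) > 0)})"

text \<open>
  The normalised absolute value, i.e. the one extending a \<open>p\<close>-adic absolute value of \<open>\<rat>\<close>, raised
  to the power of the local degree.
\<close>

definition finite_abs :: "qbar set \<Rightarrow> (qbar \<Rightarrow> int) \<Rightarrow> qbar \<Rightarrow> real" where
  "finite_abs K v x = (if x = 0 then 0 else real (residue_card K v) powi (- v x))"

text \<open>
  Summing over all complex embeddings (instead of over archimedean places) accounts for the local
  degree 2 of the complex places. The sum over the finite places has finite support.
\<close>

definition height_over :: "qbar set \<Rightarrow> qbar \<Rightarrow> qbar \<Rightarrow> real" where
  "height_over K x y =
     ((\<Sum>\<tau>\<in>embeddings K. ln (max (norm (\<tau> x)) (norm (\<tau> y)))) +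
      (\<Sum>\<^sub>\<infinity>v\<in>finite_places K. ln (max (finite_abs K v x) (finite_abs K v y)))) / real (nf_degree K)"

text \<open>
  The value of \<open>height_over\<close> depends neither on the number field nor on the choice of homogeneous
  coordinates in it.
\<close>

definition height :: "p1 \<Rightarrow> real" where
  "height p = (THE r. \<exists>K x y. number_field K \<and> x \<in> K \<and> y \<in> K \<and> (x, y) \<noteq> (0, 0) \<and>
                 p = hpt x y \<and> r = height_over K x y)"


section \<open>The surface\<close>

text \<open>
  Indices live in the three-element type \<open>3\<close>, whose elements are \<open>1\<close>, \<open>2\<close> and \<open>3\<close>. A triple of
  pairs \<open>v\<close> stands for homogeneous coordinates \<open>[x : x'], [y : y'], [z : z']\<close>.
\<close>

type_synonym coords = "(qbar \<times> qbar) ^ 3"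
type_synonym point = "p1 ^ 3"

definition proj :: "coords \<Rightarrow> point" where
  "proj v = (\<chi> i. abs_p1 (v $ i))"

definition G1 :: "qbar \<Rightarrow> qbar \<Rightarrow> qbar" where
  "G1 y z = - (y^2*z^2) + 3*y^2*z + 2*y^2 - 2*y*z^2 + 3*y*z + 3*y + 2*z^2 + 2*z - 1"

definition G2 :: "qbar \<Rightarrow> qbar \<Rightarrow> qbar" where
  "G2 y z = 2*y^2*z^2 + 3*y^2*z + 3*y^2 + 2*y*z^2 + 2*y*z + 3*z^2 + z + 2"

definition G3 :: "qbar \<Rightarrow> qbar \<Rightarrow> qbar" where
  "G3 y z = y^2*z + y^2 + y + z^2 + z"

definition L1 :: "qbar \<Rightarrow> qbar \<Rightarrow> qbar" where
  "L1 y z = y*z - y - z"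

definition L2 :: "qbar \<Rightarrow> qbar \<Rightarrow> qbar" where
  "L2 y z = y*z + 1"

text \<open>\<open>G1h\<close>, \<open>G2h\<close>, \<open>G3h\<close> are the homogenisations of bidegree (2,2), and \<open>L1h\<close>, \<open>L2h\<close> those of
  bidegree (1,1).\<close>

definition G1h :: "qbar \<Rightarrow> qbar \<Rightarrow> qbar \<Rightarrow> qbar \<Rightarrow> qbar" where
  "G1h y y' z z' = - (y^2*z^2) + 3*y^2*z*z' + 2*y^2*z'^2 - 2*y*y'*z^2 + 3*y*y'*z*z' + 3*y*y'*z'^2
     + 2*y'^2*z^2 + 2*y'^2*z*z' - y'^2*z'^2"

definition G2h :: "qbar \<Rightarrow> qbar \<Rightarrow> qbar \<Rightarrow> qbar \<Rightarrow> qbar" where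
  "G2h y y' z z' = 2*y^2*z^2 + 3*y^2*z*z' + 3*y^2*z'^2 + 2*y*y'*z^2 + 2*y*y'*z*z'
     + 3*y'^2*z^2 + y'^2*z*z' + 2*y'^2*z'^2"

definition G3h :: "qbar \<Rightarrow> qbar \<Rightarrow> qbar \<Rightarrow> qbar \<Rightarrow> qbar" where
  "G3h y y' z z' = y^2*z*z' + y^2*z'^2 + y*y'*z'^2 + y'^2*z^2 + y'^2*z*z'"

definition L1h :: "qbar \<Rightarrow> qbar \<Rightarrow> qbar \<Rightarrow> qbar \<Rightarrow> qbar" where
  "L1h y y' z z' = y*z - y*z' - y'*z"

definition L2h :: "qbar \<Rightarrow> qbar \<Rightarrow> qbar \<Rightarrow> qbar \<Rightarrow> qbar" where
  "L2h y y' z z' = y*z + y'*z'"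

definition surface_form :: "coords \<Rightarrow> qbar" where
  "surface_form v =
     (let (x, x') = v $ 1; (y, y') = v $ 2; (z, z') = v $ 3
      in G1h y y' z z' * x^2 + G2h y y' z z' * x * x'
         + (3 * G3h y y' z z' - 2 * L1h y y' z z' * L2h y y' z z') * x'^2)"

lemma surface_form_affine:
  fixes v :: coords
  assumes "v $ 1 = (x, 1)" "v $ 2 = (y, 1)" "v $ 3 = (z, 1)"
  shows "surface_form v = G1 y z * x^2 + G2 y z * x + 3 * G3 y z - 2 * L1 y z * L2 y z"
  using assms
  by (simp add: surface_form_def G1_def G2_def G3_def L1_def L2_def
      G1h_def G2h_def G3h_def L1h_def L2h_def)

definition cone :: "coords set" where
  "cone = {v. (\<forall>i. v $ i \<noteq> (0, 0)) \<and> surface_form v = 0}"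

definition Y :: "point set" where
  "Y = proj ` cone"

definition P0 :: point where
  "P0 = (\<chi> i. hpt 0 1)"

lemma P0_in_Y: "P0 \<in> Y"
proof -
  let ?v = "(\<chi> i. (0, 1)) :: coords"
  have "surface_form ?v = 0"
    by (subst surface_form_affine[of _ 0 0 0]) (simp_all add: G3_def L1_def)
  then have "?v \<in> cone" by (simp add: cone_def)
  moreover have "P0 = proj ?v" by (simp add: P0_def proj_def vec_eq_iff)
  ultimately show ?thesis unfolding Y_def by blast
qed


section \<open>Automorphisms and involutions\<close>

text \<open>\<open>trihom d F\<close>: the function \<open>F\<close> is a polynomial in the homogeneous coordinates, homogeneous
  of degree \<open>d $ i\<close> in the \<open>i\<close>-th pair of coordinates.\<close>

inductive trihom :: "int ^ 3 \<Rightarrow> (coords \<Rightarrow> qbar) \<Rightarrow> bool" where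
  const: "trihom 0 (\<lambda>v. c)"
| fst_coord: "trihom (axis i 1) (\<lambda>v. fst (v $ i))"
| snd_coord: "trihom (axis i 1) (\<lambda>v. snd (v $ i))"
| add: "trihom d F \<Longrightarrow> trihom d G \<Longrightarrow> trihom d (\<lambda>v. F v + G v)"
| mult: "trihom d F \<Longrightarrow> trihom e G \<Longrightarrow> trihom (d + e) (\<lambda>v. F v * G v)"

text \<open>
  Morphisms from \<open>Y\<close> to the projective line. If a local expression is valid only on a smaller
  neighbourhood, given by the nonvanishing of a form \<open>H\<close>, multiply both forms by \<open>H\<close>.
\<close>

definition regular_to_p1 :: "(point \<Rightarrow> p1) \<Rightarrow> bool" where
  "regular_to_p1 f \<longleftrightarrow> (\<forall>u\<in>cone. \<exists>d F G. trihom d F \<and> trihom d G \<and> (F u, G u) \<noteq> (0, 0) \<and>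
     (\<forall>v\<in>cone. (F v, G v) \<noteq> (0, 0) \<longrightarrow> f (proj v) = hpt (F v) (G v)))"

definition automorphism :: "(point \<Rightarrow> point) \<Rightarrow> bool" where
  "automorphism \<sigma> \<longleftrightarrow> bij_betw \<sigma> Y Y \<and>
     (\<forall>i. regular_to_p1 (\<lambda>P. \<sigma> P $ i)) \<and> (\<forall>i. regular_to_p1 (\<lambda>P. inv_into Y \<sigma> P $ i))"

text \<open>The fibres of the projection forgetting the \<open>i\<close>-th coordinate have one or two points;
  \<open>invol i\<close> interchanges the points of each fibre.\<close>

definition forget_fibre :: "3 \<Rightarrow> point \<Rightarrow> point set" where
  "forget_fibre i P = {Q \<in> Y. \<forall>j. j \<noteq> i \<longrightarrow> Q $ j = P $ j}"

definition invol :: "3 \<Rightarrow> point \<Rightarrow> point" where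
  "invol i P = (if forget_fibre i P \<subseteq> {P} then P else (THE Q. Q \<in> forget_fibre i P \<and> Q \<noteq> P))"

definition invol3 :: "3 \<Rightarrow> 3 \<Rightarrow> 3 \<Rightarrow> point \<Rightarrow> point" where
  "invol3 i j k = invol i \<circ> invol j \<circ> invol k"


section \<open>The N\'eron-Severi space\<close>

text \<open>
  The Picard number is 3, so the classes of the fibres of the three projections form a basis of the
  real N\'eron-Severi space; its elements are represented by their coordinates in this basis.
\<close>

type_synonym ns = "real ^ 3"

definition D :: "3 \<Rightarrow> ns" where
  "D i = axis i 1"

text \<open>The bilinear form with \<open>D i \<cdot> D i = 0\<close> and \<open>D i \<cdot> D j = 2\<close> for \<open>i \<noteq> j\<close>.\<close>

definition intersection :: "ns \<Rightarrow> ns \<Rightarrow> real" where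
  "intersection A B = (\<Sum>i\<in>UNIV. \<Sum>j\<in>UNIV. A $ i * B $ j * (if i = j then 0 else 2))"

text \<open>
  Global sections of the line bundle \<open>O(a)\<close> restricted to \<open>Y\<close>, as functions on the cone: locally
  they are quotients of forms whose multidegrees differ by \<open>a\<close>. The entries of \<open>a\<close> may be
  negative. The class of \<open>O(a)\<close> is the sum of the \<open>a $ i\<close> times \<open>D i\<close>.
\<close>

definition line_bundle_section :: "int ^ 3 \<Rightarrow> (coords \<Rightarrow> qbar) \<Rightarrow> bool" where
  "line_bundle_section a s \<longleftrightarrow> (\<forall>u\<in>cone. \<exists>d e N M. trihom d N \<and> trihom e M \<and> d - e = a \<and> M u \<noteq> 0 \<and>
     (\<forall>v\<in>cone. M v \<noteq> 0 \<longrightarrow> s v = N v / M v))"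

text \<open>
  For a morphism \<open>f\<close> to the projective line, \<open>f^*O(m)\<close> (with \<open>m > 0\<close>) is isomorphic to \<open>O(a)\<close>
  restricted to \<open>Y\<close>. An isomorphism is the same as a pair of sections \<open>s\<close>, \<open>t\<close> of \<open>O(a)\<close> without
  common zeros (the images of the \<open>m\<close>-th powers of the two coordinates) such that
  \<open>[s : t] = [x^m : y^m]\<close> wherever \<open>f = [x : y]\<close>.
\<close>

definition pullback_O_iso :: "(point \<Rightarrow> p1) \<Rightarrow> nat \<Rightarrow> int ^ 3 \<Rightarrow> bool" where
  "pullback_O_iso f m a \<longleftrightarrow> (\<exists>s t. line_bundle_section a s \<and> line_bundle_section a t \<and>
     (\<forall>v\<in>cone. (s v, t v) \<noteq> (0, 0) \<and>
        (\<forall>x y. (x, y) \<noteq> (0, 0) \<and> f (proj v) = hpt x y \<longrightarrow> hpt (s v) (t v) = hpt (x^m) (y^m))))"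

text \<open>
  The class \<open>E\<close> of the divisor of a fibre of \<open>f\<close>, i.e. of \<open>f^*O(1)\<close>. Multiples are allowed because
  the \<open>D i\<close> are only assumed to be a basis over the reals, so that the coordinates of an integral
  class are a priori just rational.
\<close>

definition fibre_class :: "(point \<Rightarrow> p1) \<Rightarrow> ns \<Rightarrow> bool" where
  "fibre_class f E \<longleftrightarrow>
     (\<exists>m a. m > 0 \<and> pullback_O_iso f m a \<and> E = (\<chi> i. real_of_int (a $ i) / real m))"

text \<open>
  \<open>T = \<tau>^*\<close>: the pullback of \<open>D i\<close> under \<open>\<tau>\<close> is the class of the fibres of the \<open>i\<close>-th coordinate of
  \<open>\<tau>\<close>. As the \<open>D i\<close> form a basis, every automorphism has exactly one such \<open>T\<close>.
\<close>

definition is_pullback :: "(point \<Rightarrow> point) \<Rightarrow> (ns \<Rightarrow> ns) \<Rightarrow> bool" where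
  "is_pullback \<tau> T \<longleftrightarrow> linear T \<and> (\<forall>i. fibre_class (\<lambda>P. \<tau> P $ i) (T (D i)))"


section \<open>Heights on the surface\<close>

definition h_ns :: "ns \<Rightarrow> point \<Rightarrow> real" where
  "h_ns E P = (\<Sum>i\<in>UNIV. E $ i * height (P $ i))"

text \<open>Weil heights associated to a class are determined up to a bounded function.\<close>

definition weil_height :: "ns \<Rightarrow> (point \<Rightarrow> real) \<Rightarrow> bool" where
  "weil_height E g \<longleftrightarrow> (\<exists>C. \<forall>P\<in>Y. \<bar>g P - h_ns E P\<bar> \<le> C)"

definition \<gamma> :: real where
  "\<gamma> = (1 + sqrt 5) / 2"

definition \<omega> :: real where
  "\<omega> = \<gamma> ^ 6"

definition E_class :: "3 \<Rightarrow> 3 \<Rightarrow> 3 \<Rightarrow> ns" where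
  "E_class i j k = (\<gamma> / 2) *\<^sub>R (- D i + \<gamma> *\<^sub>R D j + \<gamma>\<^sup>2 *\<^sub>R D k)"

text \<open>Note the reversal of the indices in the automorphism.\<close>

definition canonical_height :: "3 \<Rightarrow> 3 \<Rightarrow> 3 \<Rightarrow> point \<Rightarrow> real" where
  "canonical_height i j k P = lim (\<lambda>n. h_ns (E_class i j k) ((invol3 k j i ^^ n) P) / \<omega> ^ n)"

definition canonical_vector_height :: "(point \<Rightarrow> ns) \<Rightarrow> bool" where
  "canonical_vector_height h \<longleftrightarrow>
     (\<forall>E g. weil_height E g \<longrightarrow> (\<exists>C. \<forall>P\<in>Y. \<bar>intersection (h P) E - g P\<bar> \<le> C)) \<and>
     (\<forall>\<sigma> T. automorphism \<sigma> \<and> is_pullback (inv_into Y \<sigma>) T \<longrightarrow> (\<forall>P\<in>Y. h (\<sigma> P) = T (h P)))"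

end

theory Submission
  imports Defs
begin

text \<open>
  A canonical vector height \<open>h\<close> would determine all canonical heights linearly: the vector
  \<open>E_class i j k\<close> is an eigenvector, with eigenvalue \<open>\<omega> > 1\<close>, of the composite of the
  pullbacks under the three involutions, so equivariance turns the intersection number of \<open>h P\<close>
  with this vector into \<open>\<omega>\<^sup>-\<^sup>n\<close> times its value at the \<open>n\<close>-th iterate. There it differs from the Weil
  height by a bounded amount, and dividing by \<open>\<omega>\<^sup>n\<close> leaves exactly the canonical height
  (\<open>canonical_height_eq_intersection\<close>). Hence every linear relation between the vectors
  \<open>E_class i j k\<close>, which live in a space of dimension three, is inherited by the canonical heights
  of a point. The relation
  \<open>E_class 2 1 3 - E_class 3 1 2 = (\<gamma>\<^sup>2 + 1) *\<^sub>R (E_class 1 2 3 - E_class 1 3 2)\<close>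
  (\<open>E_class_relation\<close>) is incompatible with the given estimates: its left side would be at least
  about \<open>-0.24\<close>, its right side at most about \<open>-1.3\<close>.

  The geometric input is that each involution is an automorphism in the sense of regular maps and
  that its pullback negates one basis vector while adding twice it to the two others
  (\<open>automorphism_invol\<close>, \<open>is_pullback_invol\<close>). In the direction \<open>i\<close> the surface has the equation
  \<open>a x\<^sup>2 + b x x' + c x'\<^sup>2 = 0\<close>, where \<open>a\<close>, \<open>b\<close>, \<open>c\<close> are forms of bidegree (2,2) in the other two pairs of
  coordinates. By Vieta's formulas, the second root \<open>[s : t]\<close> satisfies
  \<open>x s = c\<close>, \<open>x' t = a\<close> and \<open>x t + x' s = - b\<close>. These equations say at once that \<open>[s : t]\<close>
  depends regularly on the point, and that \<open>s\<close> and \<open>t\<close> are sections of the line bundle of degree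
  \<open>-1\<close> in the direction \<open>i\<close> and \<open>2\<close> in the others. The sections have no common zero because \<open>a\<close>, \<open>b\<close>
  and \<open>c\<close> have none (\<open>no_degenerate_fibre\<close>), which rests on explicit certificates.
\<close>

section \<open>Points of the projective line and roots of binary quadratic forms\<close>

lemma hpt_eq_iff_p1_rel:
  assumes "p \<noteq> (0, 0)" "q \<noteq> (0, 0)"
  shows "abs_p1 p = abs_p1 q \<longleftrightarrow> p1_rel p q"
proof -
  have "p1_rel r r" if "r \<noteq> (0, 0)" for r
    using that by (auto simp: p1_rel_def intro!: exI[of _ 1])
  then show ?thesis
    using assms Quotient3_rel[OF Quotient3_p1, of p q] by blast
qed

lemma hpt_eq_iff:
  assumes "(x, y) \<noteq> (0, 0)" "(x', y') \<noteq> (0, 0)"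
  shows "hpt x y = hpt x' y' \<longleftrightarrow> x * y' = x' * y"
proof -
  have "(\<exists>c. x = c * x' \<and> y = c * y') \<longleftrightarrow> x * y' = x' * y"
  proof
    assume eq: "x * y' = x' * y"
    show "\<exists>c. x = c * x' \<and> y = c * y'"
    proof (cases "x' = 0")
      case True
      then show ?thesis using assms eq by (intro exI[of _ "y / y'"]) auto
    next
      case False
      then show ?thesis using eq by (intro exI[of _ "x / x'"]) (auto simp: field_simps)
    qed
  qed auto
  then show ?thesis
    using assms by (simp add: hpt_eq_iff_p1_rel p1_rel_def)
qed

lemma hpt_scale:
  assumes "c \<noteq> 0" "(x, y) \<noteq> (0, 0)"
  shows "hpt (c * x) (c * y) = hpt x y"
  using assms by (subst hpt_eq_iff) auto

text \<open>
  Vieta's formulas on the projective line: if \<open>[x : x']\<close> is a root of the form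
  \<open>a r\<^sup>2 + b r r' + c r'\<^sup>2\<close>, the pair below is the unique \<open>(s, t)\<close> for which the form is
  \<open>(x' r - x r') (t r - s r')\<close>. The case distinctions pick an equation in which one can divide.
\<close>

definition other_root :: "'a :: field \<Rightarrow> 'a \<Rightarrow> 'a \<Rightarrow> 'a \<times> 'a \<Rightarrow> 'a \<times> 'a" where
  "other_root a b c p =
     (if fst p \<noteq> 0 then c / fst p else - b / snd p, if snd p \<noteq> 0 then a / snd p else - b / fst p)"

lemma vieta:
  fixes a b c :: "'a :: field"
  assumes root: "a * (fst p)^2 + b * fst p * snd p + c * (snd p)^2 = 0" and p: "p \<noteq> (0, 0)"
  shows "fst p * fst (other_root a b c p) = c"
    and "snd p * snd (other_root a b c p) = a"
    and "fst p * snd (other_root a b c p) + snd p * fst (other_root a b c p) = - b"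
proof -
  obtain x x' where px: "p = (x, x')" by (cases p)
  have sum: "x * (a / x') + x' * (c / x) = - b" if nz: "x \<noteq> 0" "x' \<noteq> 0"
  proof -
    have "x * (a / x') + x' * (c / x) = (a * x^2 + c * x'^2) / (x * x')"
      using nz by (simp add: field_simps power2_eq_square)
    also have "a * x^2 + c * x'^2 = - b * (x * x')"
      using root unfolding px by (simp add: algebra_simps eq_neg_iff_add_eq_0)
    finally show ?thesis using nz by simp
  qed
  show "fst p * fst (other_root a b c p) = c" "snd p * snd (other_root a b c p) = a"
    "fst p * snd (other_root a b c p) + snd p * fst (other_root a b c p) = - b"
    using root p sum unfolding px other_root_def by (auto simp: power2_eq_square)
qed

lemma quadratic_factors:
  fixes a b c :: "'a :: field"
  assumes "a * (fst p)^2 + b * fst p * snd p + c * (snd p)^2 = 0" "p \<noteq> (0, 0)"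
  shows "a * r^2 + b * r * r' + c * r'^2 =
    (snd p * r - fst p * r') * (snd (other_root a b c p) * r - fst (other_root a b c p) * r')"
proof -
  note v = vieta[OF assms]
  have b: "b = - (fst p * snd (other_root a b c p) + snd p * fst (other_root a b c p))"
    using v(3) by simp
  show ?thesis
    by (subst (1) v(1)[symmetric], subst (1) v(2)[symmetric], subst (1) b)
      (simp add: algebra_simps power2_eq_square)
qed


section \<open>Multihomogeneous forms\<close>

definition set_coord :: "3 \<Rightarrow> qbar \<times> qbar \<Rightarrow> coords \<Rightarrow> coords" where
  "set_coord i w v = (\<chi> j. if j = i then w else v $ j)"

lemma set_coord_nth [simp]:
  "set_coord i w v $ j = (if j = i then w else v $ j)"
  by (simp add: set_coord_def)

lemma set_coord_same [simp]: "set_coord i (v $ i) v = v"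
  by (simp add: vec_eq_iff)

lemma trihom_cong: "trihom d F \<Longrightarrow> d = e \<Longrightarrow> F = G \<Longrightarrow> trihom e G"
  by simp

lemma trihom_cmult: "trihom d F \<Longrightarrow> trihom d (\<lambda>v. c * F v)"
  using trihom.mult[OF trihom.const[of c]] by simp

lemma trihom_uminus: "trihom d F \<Longrightarrow> trihom d (\<lambda>v. - F v)"
  using trihom_cmult[of d F "-1"] by simp

lemma trihom_diff: "trihom d F \<Longrightarrow> trihom d G \<Longrightarrow> trihom d (\<lambda>v. F v - G v)"
  using trihom.add[OF _ trihom_uminus] by fastforce

lemma trihom_square: "trihom d F \<Longrightarrow> trihom (d + d) (\<lambda>v. (F v)^2)"
  using trihom.mult[of d F d F] by (simp only: power2_eq_square)

text \<open>
  Freezing one pair of coordinates leaves a form of degree zero in it. Since the coefficients of the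
  surface form in one direction are combinations of its values at frozen coordinates, this yields
  their multidegrees without expanding them.
\<close>

lemma trihom_set_coord:
  "trihom d F \<Longrightarrow> trihom (\<chi> j. if j = i then 0 else d $ j) (\<lambda>v. F (set_coord i w v))"
proof (induction rule: trihom.induct)
  case (const c)
  show ?case by (rule trihom_cong[OF trihom.const]) (auto simp: vec_eq_iff)
next
  case (fst_coord k)
  show ?case
  proof (cases "k = i")
    case True
    then show ?thesis
      by (intro trihom_cong[OF trihom.const[of "fst w"]]) (auto simp: vec_eq_iff axis_def)
  next
    case False
    then show ?thesis
      by (intro trihom_cong[OF trihom.fst_coord[of k]]) (auto simp: vec_eq_iff axis_def)
  qed
next
  case (snd_coord k)
  show ?case
  proof (cases "k = i")
    case True
    then show ?thesis
      by (intro trihom_cong[OF trihom.const[of "snd w"]]) (auto simp: vec_eq_iff axis_def)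
  next
    case False
    then show ?thesis
      by (intro trihom_cong[OF trihom.snd_coord[of k]]) (auto simp: vec_eq_iff axis_def)
  qed
next
  case (add d F G)
  then show ?case by (intro trihom.add)
next
  case (mult d F e G)
  show ?case by (rule trihom_cong[OF trihom.mult[OF mult.IH]]) (auto simp: vec_eq_iff)
qed

lemma trihom_scale:
  assumes "trihom d F" and c: "\<And>i. c i \<noteq> 0"
  shows "F (\<chi> i. (c i * fst (v $ i), c i * snd (v $ i))) = (\<Prod>i\<in>UNIV. c i powi (d $ i)) * F v"
  using assms(1)
proof (induction rule: trihom.induct)
  case (fst_coord k)
  have "(\<Prod>i\<in>UNIV. c i powi (axis k 1 $ i)) = (\<Prod>i\<in>UNIV. if i = k then c i else 1)"
    by (rule prod.cong) (auto simp: axis_def)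
  then show ?case by simp
next
  case (snd_coord k)
  have "(\<Prod>i\<in>UNIV. c i powi (axis k 1 $ i)) = (\<Prod>i\<in>UNIV. if i = k then c i else 1)"
    by (rule prod.cong) (auto simp: axis_def)
  then show ?case by simp
next
  case (add d F G)
  then show ?case by (simp add: distrib_left)
next
  case (mult d F e G)
  then show ?case using c by (simp add: power_int_add prod.distrib mult_ac)
qed simp

text \<open>
  The degree is a separate premise, so that the introduction rules can first compute the degree of
  a monomial from its factors and compare it with the expected one afterwards.
\<close>

lemma trihom_deg: "trihom d F \<Longrightarrow> d = e \<Longrightarrow> trihom e F"
  by simp

lemma trihom_surface_form: "trihom (\<chi> i. 2) surface_form"
proof -
  let ?d = "\<lambda>m n. \<chi> i. if i = 1 then 0 else if i = 2 then m else (n::int)"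
  note factor = trihom.const trihom.fst_coord trihom.snd_coord trihom_square trihom.mult
  note deg = vec_eq_iff forall_3 axis_def
  have G: "trihom (?d 2 2) (\<lambda>v. G1h (fst (v $ 2)) (snd (v $ 2)) (fst (v $ 3)) (snd (v $ 3)))"
    "trihom (?d 2 2) (\<lambda>v. G2h (fst (v $ 2)) (snd (v $ 2)) (fst (v $ 3)) (snd (v $ 3)))"
    "trihom (?d 2 2) (\<lambda>v. G3h (fst (v $ 2)) (snd (v $ 2)) (fst (v $ 3)) (snd (v $ 3)))"
    unfolding G1h_def G2h_def G3h_def
    by (intro trihom.add trihom_diff trihom_uminus; rule trihom_deg, (rule factor)+, simp add: deg)+
  have L: "trihom (?d 1 1) (\<lambda>v. L1h (fst (v $ 2)) (snd (v $ 2)) (fst (v $ 3)) (snd (v $ 3)))"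
    "trihom (?d 1 1) (\<lambda>v. L2h (fst (v $ 2)) (snd (v $ 2)) (fst (v $ 3)) (snd (v $ 3)))"
    unfolding L1h_def L2h_def
    by (intro trihom.add trihom_diff; rule trihom_deg, (rule factor)+, simp add: deg)+
  have C: "trihom (?d 2 2) (\<lambda>v. 3 * G3h (fst (v $ 2)) (snd (v $ 2)) (fst (v $ 3)) (snd (v $ 3))
      - 2 * L1h (fst (v $ 2)) (snd (v $ 2)) (fst (v $ 3)) (snd (v $ 3))
          * L2h (fst (v $ 2)) (snd (v $ 2)) (fst (v $ 3)) (snd (v $ 3)))"
    by (intro trihom_diff; rule trihom_deg, (rule G L factor)+, simp add: deg)
  have "trihom (\<chi> i. 2) (\<lambda>v. surface_form v)"
    unfolding surface_form_def Let_def case_prod_unfold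
    by (intro trihom.add; rule trihom_deg, (rule G C factor)+, simp add: deg)
  then show ?thesis by simp
qed


section \<open>Absence of degenerate fibres\<close>

text \<open>
  In the next three lemmas, \<open>y\<close> and \<open>z\<close> stand for the two coordinates other than the first, second
  and third one, respectively, and the hypotheses are the vanishing of the coefficients \<open>a\<close>, \<open>b\<close>, \<open>c\<close>
  of the equation in that direction. Away from \<open>y' = 0\<close> and \<open>z' = 0\<close>, their having no common zero is
  witnessed by a combination of them that equals a nonzero integer times \<open>y'\<^sup>5 z'\<^sup>3\<close>. The three
  cofactors have bidegree (3,1), because in bidegree (5,3) the number 24 of unknowns equals the number
  of monomials; the linear system is nonsingular exactly when there is no common zero, its
  determinant being the resultant up to a constant factor. On each of the lines \<open>y' = 0\<close> and
  \<open>z' = 0\<close> the coefficients restrict to three linearly independent binary quadratic forms, so the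
  squares of both remaining coordinates are combinations of them.
\<close>

lemma no_degenerate_fibre_1:
  fixes y y' z z' :: "'a :: field_char_0"
  assumes A: "- (y^2*z^2) + 3*y^2*z*z' + 2*y^2*z'^2 - 2*y*y'*z^2 + 3*y*y'*z*z' + 3*y*y'*z'^2
      + 2*y'^2*z^2 + 2*y'^2*z*z' - y'^2*z'^2 = 0" (is "?A = 0")
    and B: "2*y^2*z^2 + 3*y^2*z*z' + 3*y^2*z'^2 + 2*y*y'*z^2 + 2*y*y'*z*z' + 3*y'^2*z^2
      + y'^2*z*z' + 2*y'^2*z'^2 = 0" (is "?B = 0")
    and C: "- (2*y^2*z^2) + 5*y^2*z*z' + 3*y^2*z'^2 + 2*y*y'*z^2 - 2*y*y'*z*z' + 5*y*y'*z'^2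
      + 3*y'^2*z^2 + 5*y'^2*z*z' = 0" (is "?C = 0")
  shows "(y, y') = (0, 0) \<or> (z, z') = (0, 0)"
proof -
  have "(27887109851081::'a) * (y'^5 * z'^3) =
    (8222711263892*y^3*z + 9381151960014*y^3*z' + 204678186196*y^2*y'*z
      + 6596435665832*y^2*y'*z' - 4283191366416*y*y'^2*z + 5698461483466*y*y'^2*z'
      - 11986893360018*y'^3*z + 1287853421045*y'^3*z') * ?A +
    (- (460350812125*y^3*z) - 888899947071*y^3*z' + 3588789340364*y^2*y'*z
      + 8190934746405*y^2*y'*z' - 3447661716614*y*y'^2*z + 24113765976828*y*y'^2*z'
      + 8621274447577*y'^3*z + 14587481636063*y'^3*z') * ?B +
    (- (4571706444071*y^3*z) - 5365201359605*y^3*z' - 9768318272822*y^2*y'*z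
      - 13027708217632*y^2*y'*z' - 7015647772462*y*y'^2*z - 9076678317532*y*y'^2*z'
      - 630012207565*y'^3*z - 9278526146665*y'^3*z') * ?C"
    by (simp add: algebra_simps eval_nat_numeral)
  then have "y' = 0 \<or> z' = 0"
    unfolding A B C by simp
  moreover have "y = 0 \<or> z = 0 \<and> z' = 0" if "y' = 0"
  proof -
    have "(2::'a) * (y^2 * z^2) = - 6 * ?A + ?B + 3 * ?C"
      by (simp add: that algebra_simps)
    then have zero1: "y = 0 \<or> z = 0"
      unfolding A B C by simp
    have "(2::'a) * (y^2 * z'^2) = 16 * ?A - ?B - 9 * ?C"
      by (simp add: that algebra_simps)
    then have zero2: "y = 0 \<or> z' = 0"
      unfolding A B C by simp
    from zero1 zero2 show ?thesis by blast
  qed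
  moreover have "z = 0 \<or> y = 0 \<and> y' = 0" if "z' = 0"
  proof -
    have "(4::'a) * (z^2 * y^2) = ?B - ?C"
      by (simp add: that algebra_simps)
    then have zero1: "z = 0 \<or> y = 0"
      unfolding A B C by simp
    have "(20::'a) * (z^2 * y'^2) = 4 * ?A + 3 * ?B + ?C"
      by (simp add: that algebra_simps)
    then have zero2: "z = 0 \<or> y' = 0"
      unfolding A B C by simp
    from zero1 zero2 show ?thesis by blast
  qed
  ultimately show ?thesis by auto
qed

lemma no_degenerate_fibre_2:
  fixes y y' z z' :: "'a :: field_char_0"
  assumes A: "- (y^2*z^2) + 3*y^2*z*z' + 2*y^2*z'^2 + 2*y*y'*z^2 + 3*y*y'*z*z' + 3*y*y'*z'^2
      - 2*y'^2*z^2 + 5*y'^2*z*z' + 3*y'^2*z'^2 = 0" (is "?A = 0")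
    and B: "- (2*y^2*z^2) + 3*y^2*z*z' + 3*y^2*z'^2 + 2*y*y'*z^2 + 2*y*y'*z*z' + 2*y'^2*z^2
      - 2*y'^2*z*z' + 5*y'^2*z'^2 = 0" (is "?B = 0")
    and C: "2*y^2*z^2 + 2*y^2*z*z' - y^2*z'^2 + 3*y*y'*z^2 + y*y'*z*z' + 2*y*y'*z'^2
      + 3*y'^2*z^2 + 5*y'^2*z*z' = 0" (is "?C = 0")
  shows "(y, y') = (0, 0) \<or> (z, z') = (0, 0)"
proof -
  have "(22784425905851::'a) * (y'^5 * z'^3) =
    (- (1523221248388*y^3*z) + 1400477514579*y^3*z' + 5279770419745*y^2*y'*z
      - 1485408905684*y^2*y'*z' + 4794872703916*y*y'^2*z - 393944087669*y*y'^2*z'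
      + 1357496441173*y'^3*z + 7803124027447*y'^3*z') * ?A +
    (1272894999087*y^3*z - 1118255636405*y^3*z' - 4446192258437*y^2*y'*z
      + 755817661252*y^2*y'*z' - 59153925316*y*y'^2*z - 2444698158536*y*y'^2*z'
      - 3665593072943*y'^3*z - 124989235298*y'^3*z') * ?B +
    (511284374893*y^3*z - 553811880057*y^3*z' - 2322907361603*y^2*y'*z
      + 2390443956011*y^2*y'*z' + 1426022497924*y*y'^2*z - 9187167094264*y*y'^2*z'
      + 3348726342744*y'^3*z - 5002024513327*y'^3*z') * ?C"
    by (simp add: algebra_simps eval_nat_numeral)
  then have "y' = 0 \<or> z' = 0"
    unfolding A B C by simp
  moreover have "y = 0 \<or> z = 0 \<and> z' = 0" if "y' = 0"
  proof -
    have "y^2 * z^2 = - 9 * ?A + 7 * ?B + 3 * ?C"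
      by (simp add: that algebra_simps)
    then have zero1: "y = 0 \<or> z = 0"
      unfolding A B C by simp
    have "y^2 * z'^2 = - 10 * ?A + 8 * ?B + 3 * ?C"
      by (simp add: that algebra_simps)
    then have zero2: "y = 0 \<or> z' = 0"
      unfolding A B C by simp
    from zero1 zero2 show ?thesis by blast
  qed
  moreover have "z = 0 \<or> y = 0 \<and> y' = 0" if "z' = 0"
  proof -
    have "(10::'a) * (z^2 * y^2) = - 3 * ?B + 2 * ?C"
      by (simp add: that algebra_simps)
    then have zero1: "z = 0 \<or> y = 0"
      unfolding A B C by simp
    have "(40::'a) * (z^2 * y'^2) = - 10 * ?A + 7 * ?B + 2 * ?C"
      by (simp add: that algebra_simps)
    then have zero2: "z = 0 \<or> y' = 0"
      unfolding A B C by simp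
    from zero1 zero2 show ?thesis by blast
  qed
  ultimately show ?thesis by auto
qed

lemma no_degenerate_fibre_3:
  fixes y y' z z' :: "'a :: field_char_0"
  assumes A: "- (y^2*z^2) - 2*y^2*z*z' + 2*y^2*z'^2 + 2*y*y'*z^2 + 2*y*y'*z*z' + 3*y*y'*z'^2
      - 2*y'^2*z^2 + 2*y'^2*z*z' + 3*y'^2*z'^2 = 0" (is "?A = 0")
    and B: "3*y^2*z^2 + 3*y^2*z*z' + 2*y^2*z'^2 + 3*y*y'*z^2 + 2*y*y'*z*z' + y*y'*z'^2
      + 5*y'^2*z^2 - 2*y'^2*z*z' + 5*y'^2*z'^2 = 0" (is "?B = 0")
    and C: "2*y^2*z^2 + 3*y^2*z*z' - y^2*z'^2 + 3*y*y'*z^2 + 2*y*y'*z'^2 + 3*y'^2*z^2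
      + 5*y'^2*z*z' = 0" (is "?C = 0")
  shows "(y, y') = (0, 0) \<or> (z, z') = (0, 0)"
proof -
  have "(12899692264797443::'a) * (y'^5 * z'^3) =
    (241284279568470*y^3*z - 72157658683210*y^3*z' - 140689004590535*y^2*y'*z
      + 367003187733966*y^2*y'*z' + 402683931153658*y*y'^2*z - 1346344201686113*y*y'^2*z'
      - 375998361346290*y'^3*z + 1456040099160571*y'^3*z') * ?A +
    (- (93344908811680*y^3*z) + 28156821802335*y^3*z' - 568393064292462*y^2*y'*z
      + 29919283699652*y^2*y'*z' + 936343756407208*y*y'^2*z - 399625109626802*y*y'^2*z'
      + 344347003405059*y'^3*z + 1706314393463146*y'^3*z') * ?B +
    (260659503001755*y^3*z - 88001673761750*y^3*z' + 289988923289843*y^2*y'*z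
      + 429525441096441*y^2*y'*z' - 561221155844482*y*y'^2*z - 1577647760569353*y*y'^2*z'
      - 824577246572625*y'^3*z - 18638268876255*y'^3*z') * ?C"
    by (simp add: algebra_simps eval_nat_numeral)
  then have "y' = 0 \<or> z' = 0"
    unfolding A B C by simp
  moreover have "y = 0 \<or> z = 0 \<and> z' = 0" if "y' = 0"
  proof -
    have "y^2 * z^2 = - 9 * ?A + 4 * ?B - 10 * ?C"
      by (simp add: that algebra_simps)
    then have zero1: "y = 0 \<or> z = 0"
      unfolding A B C by simp
    have "y^2 * z'^2 = 3 * ?A - ?B + 3 * ?C"
      by (simp add: that algebra_simps)
    then have zero2: "y = 0 \<or> z' = 0"
      unfolding A B C by simp
    from zero1 zero2 show ?thesis by blast
  qed
  moreover have "z = 0 \<or> y = 0 \<and> y' = 0" if "z' = 0"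
  proof -
    have "z^2 * y^2 = - 3 * ?A - 6 * ?B + 8 * ?C"
      by (simp add: that algebra_simps)
    then have zero1: "z = 0 \<or> y = 0"
      unfolding A B C by simp
    have "(2::'a) * (z^2 * y'^2) = 3 * ?A + 7 * ?B - 9 * ?C"
      by (simp add: that algebra_simps)
    then have zero2: "z = 0 \<or> y' = 0"
      unfolding A B C by simp
    from zero1 zero2 show ?thesis by blast
  qed
  ultimately show ?thesis by auto
qed


section \<open>The surface as a double cover in three ways\<close>

text \<open>
  The coefficients of the equation of the surface as a quadratic form in its \<open>i\<close>-th pair of
  coordinates, obtained by interpolation at \<open>[1 : 0]\<close>, \<open>[0 : 1]\<close> and \<open>[1 : 1]\<close>; this treats the
  three directions uniformly.
\<close>

definition qa :: "3 \<Rightarrow> coords \<Rightarrow> qbar" where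
  "qa i v = surface_form (set_coord i (1, 0) v)"

definition qc :: "3 \<Rightarrow> coords \<Rightarrow> qbar" where
  "qc i v = surface_form (set_coord i (0, 1) v)"

definition qb :: "3 \<Rightarrow> coords \<Rightarrow> qbar" where
  "qb i v = surface_form (set_coord i (1, 1) v) - qa i v - qc i v"

lemma surface_form_quadratic:
  "surface_form (set_coord i (x, x') v) = qa i v * x^2 + qb i v * x * x' + qc i v * x'^2"
proof -
  obtain x1 y1 where 1: "v $ 1 = (x1, y1)" by (cases "v $ 1")
  obtain x2 y2 where 2: "v $ 2 = (x2, y2)" by (cases "v $ 2")
  obtain x3 y3 where 3: "v $ 3 = (x3, y3)" by (cases "v $ 3")
  consider "i = 1" | "i = 2" | "i = 3" using exhaust_3 by blast
  then show ?thesis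
  proof cases
    case 1
    then show ?thesis
      by (simp add: 2 3 qa_def qb_def qc_def surface_form_def)
  next
    case 2
    then show ?thesis
      by (simp add: 1 3 qa_def qb_def qc_def surface_form_def G1h_def G2h_def G3h_def L1h_def L2h_def
          algebra_simps power2_eq_square)
  next
    case 3
    then show ?thesis
      by (simp add: 1 2 qa_def qb_def qc_def surface_form_def G1h_def G2h_def G3h_def L1h_def L2h_def
          algebra_simps power2_eq_square)
  qed
qed

lemma surface_form_eq_quadratic:
  fixes v :: coords
  shows "surface_form v = qa i v * (fst (v $ i))^2 + qb i v * fst (v $ i) * snd (v $ i)
     + qc i v * (snd (v $ i))^2"
  using surface_form_quadratic[of i "fst (v $ i)" "snd (v $ i)" v] by simp

text \<open>
  The projection forgetting the \<open>i\<close>-th coordinate contracts no curve, so that each of its fibres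
  consists of the roots of a nonzero quadratic form. For the points of the surface this makes the
  second root below well defined.
\<close>

lemma no_degenerate_fibre:
  fixes v :: coords
  assumes nz: "\<And>j. j \<noteq> i \<Longrightarrow> v $ j \<noteq> (0, 0)"
  shows "\<not> (qa i v = 0 \<and> qb i v = 0 \<and> qc i v = 0)"
proof
  assume "qa i v = 0 \<and> qb i v = 0 \<and> qc i v = 0"
  then have q: "qa i v = 0" "qb i v = 0" "qc i v = 0" by auto
  obtain x1 y1 where 1: "v $ 1 = (x1, y1)" by (cases "v $ 1")
  obtain x2 y2 where 2: "v $ 2 = (x2, y2)" by (cases "v $ 2")
  obtain x3 y3 where 3: "v $ 3 = (x3, y3)" by (cases "v $ 3")
  note defs = qa_def qb_def qc_def surface_form_def G1h_def G2h_def G3h_def L1h_def L2h_def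
  consider "i = 1" | "i = 2" | "i = 3" using exhaust_3 by blast
  then show False
  proof cases
    case i: 1
    have "(x2, y2) = (0, 0) \<or> (x3, y3) = (0, 0)"
      by (rule no_degenerate_fibre_1[OF trans[OF _ q(1)] trans[OF _ q(2)] trans[OF _ q(3)]])
        (simp_all add: i 2 3 defs algebra_simps power2_eq_square)
    then show False using nz[of 2] nz[of 3] by (auto simp: i 2 3)
  next
    case i: 2
    have "(x1, y1) = (0, 0) \<or> (x3, y3) = (0, 0)"
      by (rule no_degenerate_fibre_2[OF trans[OF _ q(1)] trans[OF _ q(2)] trans[OF _ q(3)]])
        (simp_all add: i 1 3 defs algebra_simps power2_eq_square)
    then show False using nz[of 1] nz[of 3] by (auto simp: i 1 3)
  next
    case i: 3
    have "(x1, y1) = (0, 0) \<or> (x2, y2) = (0, 0)"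
      by (rule no_degenerate_fibre_3[OF trans[OF _ q(1)] trans[OF _ q(2)] trans[OF _ q(3)]])
        (simp_all add: i 1 2 defs algebra_simps power2_eq_square)
    then show False using nz[of 1] nz[of 2] by (auto simp: i 1 2)
  qed
qed

abbreviation deg_q :: "3 \<Rightarrow> int ^ 3" where
  "deg_q i \<equiv> (\<chi> j. if j = i then 0 else 2)"

lemma trihom_q: "trihom (deg_q i) (qa i)" "trihom (deg_q i) (qb i)" "trihom (deg_q i) (qc i)"
proof -
  have *: "trihom (deg_q i) (\<lambda>v. surface_form (set_coord i w v))" for w
    by (rule trihom_cong[OF trihom_set_coord[OF trihom_surface_form, of i w]])
      (auto simp: vec_eq_iff)
  show a: "trihom (deg_q i) (qa i)" and c: "trihom (deg_q i) (qc i)"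
    using *[of "(1, 0)"] *[of "(0, 1)"] by (simp_all add: qa_def[abs_def] qc_def[abs_def])
  show "trihom (deg_q i) (qb i)"
    unfolding qb_def[abs_def] by (intro trihom_diff * a c)
qed

lemma cone_nz: "v \<in> cone \<Longrightarrow> v $ i \<noteq> (0, 0)"
  by (simp add: cone_def)

lemma proj_in_Y: "v \<in> cone \<Longrightarrow> proj v \<in> Y"
  by (simp add: Y_def)

lemma proj_nth: "proj v $ i = abs_p1 (v $ i)"
  by (simp add: proj_def)

text \<open>
  Multihomogeneity makes vanishing of the form independent of the representative. Thus a point with
  the same other coordinates as a given one may be assumed to have literally the same homogeneous
  coordinates there.
\<close>

lemma cone_if_proj_eq:
  fixes u w :: coords
  assumes "u \<in> cone" "proj w = proj u" and w: "\<And>i. w $ i \<noteq> (0, 0)"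
  shows "w \<in> cone"
proof -
  have "\<exists>c. c \<noteq> 0 \<and> w $ i = (c * fst (u $ i), c * snd (u $ i))" for i
  proof -
    have "abs_p1 (w $ i) = abs_p1 (u $ i)"
      using assms(2) by (simp add: proj_def vec_eq_iff)
    then have "p1_rel (w $ i) (u $ i)"
      using cone_nz[OF assms(1)] w by (simp add: hpt_eq_iff_p1_rel)
    then obtain c where c: "fst (w $ i) = c * fst (u $ i)" "snd (w $ i) = c * snd (u $ i)"
      unfolding p1_rel_def by blast
    moreover from c have "c \<noteq> 0" using w[of i] by (auto simp: prod_eq_iff)
    ultimately show ?thesis by (metis prod.collapse)
  qed
  then obtain c where c: "\<And>i. c i \<noteq> 0" "\<And>i. w $ i = (c i * fst (u $ i), c i * snd (u $ i))"
    by metis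
  then have "w = (\<chi> i. (c i * fst (u $ i), c i * snd (u $ i)))" by (simp add: vec_eq_iff)
  then have "surface_form w = 0"
    using trihom_scale[OF trihom_surface_form c(1), where v = u] assms(1) by (simp add: cone_def)
  then show ?thesis using w by (simp add: cone_def)
qed

definition conj_root :: "3 \<Rightarrow> coords \<Rightarrow> qbar \<times> qbar" where
  "conj_root i v = other_root (qa i v) (qb i v) (qc i v) (v $ i)"

lemma
  assumes "v \<in> cone"
  shows conj_root_vieta:
      "qc i v = fst (v $ i) * fst (conj_root i v)"
      "qa i v = snd (v $ i) * snd (conj_root i v)"
      "qb i v = - (fst (v $ i) * snd (conj_root i v) + snd (v $ i) * fst (conj_root i v))"
    and surface_form_factors:
      "surface_form (set_coord i (x, x') v) = (snd (v $ i) * x - fst (v $ i) * x')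
         * (snd (conj_root i v) * x - fst (conj_root i v) * x')"
proof -
  have root: "qa i v * (fst (v $ i))^2 + qb i v * fst (v $ i) * snd (v $ i)
      + qc i v * (snd (v $ i))^2 = 0"
    using assms surface_form_eq_quadratic[of v i] by (simp add: cone_def)
  note vieta = vieta[OF root cone_nz[OF assms], folded conj_root_def]
  show "qc i v = fst (v $ i) * fst (conj_root i v)"
    "qa i v = snd (v $ i) * snd (conj_root i v)"
    "qb i v = - (fst (v $ i) * snd (conj_root i v) + snd (v $ i) * fst (conj_root i v))"
    using vieta by simp_all
  show "surface_form (set_coord i (x, x') v) = (snd (v $ i) * x - fst (v $ i) * x')
         * (snd (conj_root i v) * x - fst (conj_root i v) * x')"
    unfolding conj_root_def surface_form_quadratic
    by (rule quadratic_factors[OF root cone_nz[OF assms]])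
qed

lemma conj_root_nz:
  assumes "v \<in> cone"
  shows "conj_root i v \<noteq> (0, 0)"
proof
  assume "conj_root i v = (0, 0)"
  then have "qa i v = 0 \<and> qb i v = 0 \<and> qc i v = 0"
    using conj_root_vieta[OF assms, of i] by simp
  then show False using no_degenerate_fibre[of i v] cone_nz[OF assms] by blast
qed

lemma set_conj_root_cone:
  assumes "v \<in> cone"
  shows "set_coord i (conj_root i v) v \<in> cone"
  using assms conj_root_nz[OF assms, of i]
    surface_form_factors[OF assms, of i "fst (conj_root i v)" "snd (conj_root i v)"]
  by (simp add: cone_def)

text \<open>
  Replacing the \<open>i\<close>-th pair of coordinates by \<open>(x, x')\<close> gives a product of two linear forms, whose
  zeros are the original point and its conjugate. The two may coincide, in which case the
  involution fixes the point; the description of the fibre covers this case.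
\<close>

lemma forget_fibre_eq:
  assumes v: "v \<in> cone"
  shows "forget_fibre i (proj v) = {proj v, proj (set_coord i (conj_root i v) v)}"
proof
  show "{proj v, proj (set_coord i (conj_root i v) v)} \<subseteq> forget_fibre i (proj v)"
    using proj_in_Y[OF v] proj_in_Y[OF set_conj_root_cone[OF v, of i]]
    by (auto simp: forget_fibre_def proj_nth)
next
  show "forget_fibre i (proj v) \<subseteq> {proj v, proj (set_coord i (conj_root i v) v)}"
  proof
    fix Q assume Q: "Q \<in> forget_fibre i (proj v)"
    then obtain u where u: "u \<in> cone" "Q = proj u"
      by (auto simp: forget_fibre_def Y_def)
    obtain x x' where ui: "u $ i = (x, x')" by (cases "u $ i")
    define w where "w = set_coord i (x, x') v"
    have w: "proj w = proj u"
      using Q ui by (auto simp: w_def forget_fibre_def u(2) proj_nth vec_eq_iff)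
    have "w $ j \<noteq> (0, 0)" for j
      using cone_nz[OF v] cone_nz[OF u(1), of i] ui by (simp add: w_def)
    then have "surface_form w = 0"
      using cone_if_proj_eq[OF u(1) w] by (simp add: cone_def)
    then have "x * snd (v $ i) = fst (v $ i) * x' \<or>
        x * snd (conj_root i v) = fst (conj_root i v) * x'"
      unfolding w_def surface_form_factors[OF v] by (auto simp: mult.commute)
    moreover have nz: "(x, x') \<noteq> (0, 0)" using cone_nz[OF u(1), of i] ui by simp
    ultimately have "hpt x x' = abs_p1 (v $ i) \<or> hpt x x' = abs_p1 (conj_root i v)"
      using cone_nz[OF v, of i] conj_root_nz[OF v, of i]
        hpt_eq_iff[of x x' "fst (v $ i)" "snd (v $ i)"]
        hpt_eq_iff[of x x' "fst (conj_root i v)" "snd (conj_root i v)"]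
      by simp
    then have "proj w = proj v \<or> proj w = proj (set_coord i (conj_root i v) v)"
      by (auto simp: w_def proj_nth vec_eq_iff)
    then show "Q \<in> {proj v, proj (set_coord i (conj_root i v) v)}"
      using w u(2) by simp
  qed
qed

lemma invol_eq:
  assumes "forget_fibre i P = {P, Q}"
  shows "invol i P = Q"
  using assms unfolding invol_def by (auto intro!: the_equality)

lemma invol_proj:
  assumes "v \<in> cone"
  shows "invol i (proj v) = proj (set_coord i (conj_root i v) v)"
  by (rule invol_eq[OF forget_fibre_eq[OF assms]])

lemma invol_in_Y: "P \<in> Y \<Longrightarrow> invol i P \<in> Y"
  unfolding Y_def using invol_proj set_conj_root_cone by auto

lemma invol_invol:
  assumes "P \<in> Y"
  shows "invol i (invol i P) = P"
proof (rule invol_eq)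
  obtain v where v: "v \<in> cone" "P = proj v" using assms by (auto simp: Y_def)
  have "forget_fibre i (invol i P) = forget_fibre i P"
    by (simp add: v(2) invol_proj[OF v(1)] forget_fibre_def proj_nth)
  then show "forget_fibre i (invol i P) = {invol i P, P}"
    using forget_fibre_eq[OF v(1)] by (auto simp: v(2) invol_proj[OF v(1)])
qed

lemma bij_betw_invol: "bij_betw (invol i) Y Y"
  by (rule bij_betw_byWitness[where f' = "invol i"]) (auto simp: invol_invol invol_in_Y)

lemma inv_into_invol: "P \<in> Y \<Longrightarrow> inv_into Y (invol i) P = invol i P"
  using bij_betw_invol[of i] by (intro inv_into_f_eq) (auto simp: bij_betw_def invol_invol invol_in_Y)


section \<open>The involutions are automorphisms\<close>

lemma regular_to_p1_cong:
  assumes "regular_to_p1 f" "\<And>P. P \<in> Y \<Longrightarrow> f P = g P"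
  shows "regular_to_p1 g"
  using assms(1) unfolding regular_to_p1_def
  by (metis assms(2) proj_in_Y)

lemma invol_nth:
  assumes "v \<in> cone"
  shows "invol i (proj v) $ k = abs_p1 (if k = i then conj_root i v else v $ k)"
  by (simp add: invol_proj[OF assms] proj_nth)

text \<open>
  The conjugate root \<open>[s : t]\<close> is given by forms after multiplication by \<open>x\<^sup>2\<close> or by \<open>x'\<^sup>2\<close>:
  from Vieta's formulas, \<open>x\<^sup>2 s = c x\<close> and \<open>x\<^sup>2 t = - b x - c x'\<close>, and symmetrically for \<open>x'\<^sup>2\<close>. As
  \<open>(s, t)\<close> never vanishes, the first pair of forms works exactly where \<open>x\<close> does not vanish and the
  second one where \<open>x'\<close> does not.
\<close>

lemma regular_invol: "regular_to_p1 (\<lambda>P. invol i P $ k)"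
proof (cases "k = i")
  case False
  show ?thesis
    unfolding regular_to_p1_def
  proof
    fix u assume "u \<in> cone"
    then show "\<exists>d F G. trihom d F \<and> trihom d G \<and> (F u, G u) \<noteq> (0, 0) \<and>
        (\<forall>v\<in>cone. (F v, G v) \<noteq> (0, 0) \<longrightarrow> invol i (proj v) $ k = hpt (F v) (G v))"
      using cone_nz[of u k] False
      by (intro exI[of _ "axis k 1"] exI[of _ "\<lambda>v. fst (v $ k)"] exI[of _ "\<lambda>v. snd (v $ k)"])
        (auto intro: trihom.intros simp: invol_nth)
  qed
next
  case True
  show ?thesis
    unfolding regular_to_p1_def
  proof
    fix u assume u: "u \<in> cone"
    let ?x = "\<lambda>v::coords. fst (v $ i)" and ?x' = "\<lambda>v::coords. snd (v $ i)"
    have deg: "trihom (deg_q i + axis i 1) (\<lambda>v. A v * ?x v)"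
        "trihom (deg_q i + axis i 1) (\<lambda>v. A v * ?x' v)" if "trihom (deg_q i) A" for A
      using that by (auto intro: trihom.intros)
    have main: "\<exists>d F G. trihom d F \<and> trihom d G \<and> (F u, G u) \<noteq> (0, 0) \<and>
        (\<forall>v\<in>cone. (F v, G v) \<noteq> (0, 0) \<longrightarrow> invol i (proj v) $ k = hpt (F v) (G v))"
      if F: "trihom (deg_q i + axis i 1) F" and G: "trihom (deg_q i + axis i 1) G"
        and "l u \<noteq> 0"
        and FG: "\<And>v. v \<in> cone \<Longrightarrow> F v = (l v)^2 * fst (conj_root i v)
          \<and> G v = (l v)^2 * snd (conj_root i v)" for F G and l :: "coords \<Rightarrow> qbar"
    proof (intro exI conjI ballI impI)
      show "trihom (deg_q i + axis i 1) F" "trihom (deg_q i + axis i 1) G" by fact+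
      show "(F u, G u) \<noteq> (0, 0)"
        using FG[OF u] \<open>l u \<noteq> 0\<close> conj_root_nz[OF u, of i] by (auto simp: prod_eq_iff)
      fix v assume v: "v \<in> cone" and nz: "(F v, G v) \<noteq> (0, 0)"
      then have "(l v)^2 \<noteq> 0" using FG[OF v] by auto
      then show "invol i (proj v) $ k = hpt (F v) (G v)"
        using FG[OF v] hpt_scale[of "(l v)^2" "fst (conj_root i v)" "snd (conj_root i v)"]
          conj_root_nz[OF v, of i] True
        by (simp add: invol_nth[OF v])
    qed
    show "\<exists>d F G. trihom d F \<and> trihom d G \<and> (F u, G u) \<noteq> (0, 0) \<and>
        (\<forall>v\<in>cone. (F v, G v) \<noteq> (0, 0) \<longrightarrow> invol i (proj v) $ k = hpt (F v) (G v))"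
    proof (cases "?x u = 0")
      case False
      show ?thesis
      proof (rule main[of "\<lambda>v. qc i v * ?x v" "\<lambda>v. - (qb i v * ?x v) - qc i v * ?x' v" ?x])
        fix v assume "v \<in> cone"
        note vi = conj_root_vieta[OF this, of i]
        show "qc i v * ?x v = (?x v)^2 * fst (conj_root i v)
            \<and> - (qb i v * ?x v) - qc i v * ?x' v = (?x v)^2 * snd (conj_root i v)"
          by (simp add: vi algebra_simps power2_eq_square)
      qed (use False in \<open>auto intro!: deg trihom_q trihom_diff trihom_uminus\<close>)
    next
      case x0: True
      then have "?x' u \<noteq> 0" using cone_nz[OF u, of i] by (auto simp: prod_eq_iff)
      show ?thesis
      proof (rule main[of "\<lambda>v. - (qb i v * ?x' v) - qa i v * ?x v" "\<lambda>v. qa i v * ?x' v" ?x'])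
        fix v assume "v \<in> cone"
        note vi = conj_root_vieta[OF this, of i]
        show "- (qb i v * ?x' v) - qa i v * ?x v = (?x' v)^2 * fst (conj_root i v)
            \<and> qa i v * ?x' v = (?x' v)^2 * snd (conj_root i v)"
          by (simp add: vi algebra_simps power2_eq_square)
      qed (use \<open>?x' u \<noteq> 0\<close> in \<open>auto intro!: deg trihom_q trihom_diff trihom_uminus\<close>)
    qed
  qed
qed

lemma automorphism_invol: "automorphism (invol i)"
  unfolding automorphism_def
  by (auto intro!: bij_betw_invol regular_invol
      regular_to_p1_cong[OF regular_invol[of i]] simp: inv_into_invol)


section \<open>The action on divisor classes\<close>

text \<open>
  The action of an involution on divisor classes; it is the orthogonal reflection in the
  vector \<open>D i - D j - D k\<close> of self-intersection \<open>-4\<close>.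
\<close>

definition reflect :: "3 \<Rightarrow> ns \<Rightarrow> ns" where
  "reflect i E = (\<chi> j. if j = i then - (E $ i) else E $ j + 2 * E $ i)"

lemma linear_reflect: "linear (reflect i)"
  by (rule linearI) (auto simp: reflect_def vec_eq_iff algebra_simps)

lemma section_coord:
  "line_bundle_section (axis k 1) (\<lambda>v. fst (v $ k))"
  "line_bundle_section (axis k 1) (\<lambda>v. snd (v $ k))"
  unfolding line_bundle_section_def
  by (intro ballI exI[of _ "axis k 1"] exI[of _ 0] exI[of _ "\<lambda>v. fst (v $ k)"]
      exI[of _ "\<lambda>v. snd (v $ k)"] exI[of _ "\<lambda>v. 1"]; auto intro: trihom.intros)+

text \<open>
  The two halves of the conjugate root have, locally, the presentations \<open>s = c / x\<close> and
  \<open>s = (- a x - b x') / x'\<^sup>2\<close>, and symmetrically for \<open>t\<close>. They agree on the surface, and their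
  denominators do not vanish simultaneously, so both halves are global sections, although their
  degree in the direction \<open>i\<close> is \<open>-1\<close>.
\<close>

lemma section_conj_root:
  "line_bundle_section (deg_q i - axis i 1) (\<lambda>v. fst (conj_root i v))"
  "line_bundle_section (deg_q i - axis i 1) (\<lambda>v. snd (conj_root i v))"
proof -
  let ?x = "\<lambda>v::coords. fst (v $ i)" and ?x' = "\<lambda>v::coords. snd (v $ i)"
  let ?a = "axis i 1 :: int ^ 3"
  have lin: "trihom (deg_q i + ?a) (\<lambda>v. - (A v * ?x v) - B v * ?x' v)"
    if "trihom (deg_q i) A" "trihom (deg_q i) B" for A B
    using that by (auto intro!: trihom_diff trihom_uminus intro: trihom.intros)
  have sq: "trihom (?a + ?a) (\<lambda>v. (?x v)^2)" "trihom (?a + ?a) (\<lambda>v. (?x' v)^2)"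
    by (intro trihom_square trihom.fst_coord trihom.snd_coord)+
  have alt: "?x u \<noteq> 0 \<or> ?x' u \<noteq> 0" if "u \<in> cone" for u
    using cone_nz[OF that, of i] by (auto simp: prod_eq_iff)
  have glue: "line_bundle_section (deg_q i - ?a) s"
    if N1: "trihom (deg_q i) N1" and M1: "trihom ?a M1"
      and N2: "trihom (deg_q i + ?a) N2" and M2: "trihom (?a + ?a) M2"
      and cover: "\<And>v. v \<in> cone \<Longrightarrow> M1 v \<noteq> 0 \<or> M2 v \<noteq> 0"
      and s: "\<And>v. v \<in> cone \<Longrightarrow> M1 v * s v = N1 v \<and> M2 v * s v = N2 v" for N1 M1 N2 M2 s
    unfolding line_bundle_section_def
  proof
    fix u assume u: "u \<in> cone"
    have 1: "s v = N1 v / M1 v" if "v \<in> cone" "M1 v \<noteq> 0" for v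
      using s[OF that(1)] that(2) by (auto simp: field_simps)
    have 2: "s v = N2 v / M2 v" if "v \<in> cone" "M2 v \<noteq> 0" for v
      using s[OF that(1)] that(2) by (auto simp: field_simps)
    have deg: "deg_q i + ?a - (?a + ?a) = deg_q i - ?a" by (simp add: vec_eq_iff)
    show "\<exists>d e N M. trihom d N \<and> trihom e M \<and> d - e = deg_q i - ?a \<and> M u \<noteq> 0 \<and>
        (\<forall>v\<in>cone. M v \<noteq> 0 \<longrightarrow> s v = N v / M v)"
    proof (cases "M1 u = 0")
      case False
      then show ?thesis
        using N1 M1 1 by (intro exI[of _ "deg_q i"] exI[of _ ?a] exI[of _ N1] exI[of _ M1]) simp
    next
      case True
      then have "M2 u \<noteq> 0" using cover[OF u] by simp
      then show ?thesis
        using N2 M2 2 deg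
        by (intro exI[of _ "deg_q i + ?a"] exI[of _ "?a + ?a"] exI[of _ N2] exI[of _ M2]) simp
    qed
  qed
  show "line_bundle_section (deg_q i - ?a) (\<lambda>v. fst (conj_root i v))"
  proof (rule glue[OF trihom_q(3) trihom.fst_coord lin[OF trihom_q(1,2)] sq(2)])
    fix v assume v: "v \<in> cone"
    note vi = conj_root_vieta[OF this, of i]
    show "?x v * fst (conj_root i v) = qc i v \<and>
        (?x' v)^2 * fst (conj_root i v) = - (qa i v * ?x v) - qb i v * ?x' v"
      by (simp add: vi algebra_simps power2_eq_square)
  qed (use alt in auto)
  show "line_bundle_section (deg_q i - ?a) (\<lambda>v. snd (conj_root i v))"
  proof (rule glue[OF trihom_q(1) trihom.snd_coord lin[OF trihom_q(2,3)] sq(1)])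
    fix v assume v: "v \<in> cone"
    note vi = conj_root_vieta[OF this, of i]
    show "?x' v * snd (conj_root i v) = qa i v \<and>
        (?x v)^2 * snd (conj_root i v) = - (qb i v * ?x v) - qc i v * ?x' v"
      by (simp add: vi algebra_simps power2_eq_square)
  qed (use alt in auto)
qed

lemma fibre_class_of_sections:
  assumes s: "line_bundle_section a s" and t: "line_bundle_section a t"
    and nz: "\<And>v. v \<in> cone \<Longrightarrow> (s v, t v) \<noteq> (0, 0)"
    and f: "\<And>v. v \<in> cone \<Longrightarrow> f (proj v) = hpt (s v) (t v)"
  shows "fibre_class f (\<chi> i. real_of_int (a $ i))"
proof -
  have "pullback_O_iso f 1 a"
    unfolding pullback_O_iso_def
    by (rule exI[of _ s], rule exI[of _ t]) (use assms in auto)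
  then show ?thesis
    unfolding fibre_class_def by (intro exI[of _ 1] exI[of _ a]) (simp add: vec_eq_iff)
qed

text \<open>
  The coordinates other than the \<open>i\<close>-th are preserved, hence so are their fibre classes. The \<open>i\<close>-th
  coordinate of the image is the conjugate root, whose sections have the degree of
  \<open>2 D j + 2 D k - D i\<close>.
\<close>

lemma is_pullback_invol: "is_pullback (inv_into Y (invol i)) (reflect i)"
  unfolding is_pullback_def
proof (intro conjI allI linear_reflect)
  fix k
  have f: "inv_into Y (invol i) (proj v) $ k = abs_p1 (if k = i then conj_root i v else v $ k)"
    if "v \<in> cone" for v
    using that by (simp add: inv_into_invol proj_in_Y invol_nth)
  show "fibre_class (\<lambda>P. inv_into Y (invol i) P $ k) (reflect i (D k))"
  proof (cases "k = i")
    case True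
    have "reflect i (D k) = (\<chi> j. real_of_int ((deg_q i - axis i 1) $ j))"
      by (auto simp: True reflect_def D_def axis_def vec_eq_iff)
    then show ?thesis
      using fibre_class_of_sections[OF section_conj_root] f conj_root_nz True by simp
  next
    case False
    have "reflect i (D k) = (\<chi> j. real_of_int (axis k 1 $ j))"
      using False by (auto simp: reflect_def D_def axis_def vec_eq_iff)
    then show ?thesis
      using fibre_class_of_sections[OF section_coord] f cone_nz False by simp
  qed
qed

lemma intersection_3:
  "intersection A B = 2 * (A$1 * B$2 + A$1 * B$3 + A$2 * B$1 + A$2 * B$3 + A$3 * B$1 + A$3 * B$2)"
  by (simp add: intersection_def sum_3 algebra_simps)

lemma intersection_reflect: "intersection (reflect i A) B = intersection A (reflect i B)"
  using exhaust_3[of i] by (auto simp: intersection_3 reflect_def algebra_simps)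

lemma intersection_scale: "intersection A (c *\<^sub>R B) = c * intersection A B"
  by (simp add: intersection_3 algebra_simps)

lemma intersection_diff: "intersection A (B - C) = intersection A B - intersection A C"
  by (simp add: intersection_3 algebra_simps)

lemma gamma_square: "\<gamma>^2 = \<gamma> + 1"
  by (simp add: \<gamma>_def power2_eq_square field_simps)

lemma gamma_gt_1: "\<gamma> > 1"
  by (simp add: \<gamma>_def)

lemma gamma_cube: "\<gamma>^3 = 2 * \<gamma> + 1"
  using gamma_square by (simp add: power3_eq_cube power2_eq_square distrib_left distrib_right)

lemma omega_eq: "\<omega> = 8 * \<gamma> + 5"
proof -
  have "\<omega> = (\<gamma>^3)^2" by (simp add: \<omega>_def)
  also have "\<dots> = 4 * \<gamma>^2 + 4 * \<gamma> + 1"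
    by (simp add: gamma_cube power2_eq_square algebra_simps)
  finally show ?thesis by (simp add: gamma_square)
qed

text \<open>
  Every reflection applied to a vector proportional to \<open>(-1, \<gamma>, \<gamma>\<^sup>2)\<close>, with the last entry in the
  reflected direction, multiplies it by \<open>\<gamma>\<^sup>2\<close> and rotates its entries, because
  \<open>\<gamma>\<^sup>2 = \<gamma> + 1\<close>. After three reflections the entries are back in place, which accounts for
  the eigenvalue \<open>\<gamma>\<^sup>6\<close>.
\<close>

lemma reflect_E_class:
  assumes "i \<noteq> j" "j \<noteq> k" "i \<noteq> k"
  shows "reflect i (reflect j (reflect k (E_class i j k))) = \<omega> *\<^sub>R E_class i j k"
proof -
  have m: "m = i \<or> m = j \<or> m = k" for m
    using exhaust_3[of i] exhaust_3[of j] exhaust_3[of k] exhaust_3[of m] assms by auto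
  let ?w = "reflect i (reflect j (reflect k (E_class i j k)))"
  have E: "E_class i j k $ i = - \<gamma> / 2" "E_class i j k $ j = \<gamma>^2 / 2" "E_class i j k $ k = \<gamma>^3 / 2"
    using assms by (auto simp: E_class_def D_def axis_def power2_eq_square power3_eq_cube)
  have sq: "\<gamma> * \<gamma> = \<gamma> + 1" using gamma_square by (simp add: power2_eq_square)
  have sq': "\<gamma> * (\<gamma> * c) = (\<gamma> + 1) * c" for c
    by (simp only: mult.assoc[symmetric] sq)
  have "?w $ m = \<omega> * E_class i j k $ m" for m
    using m[of m] assms
    by (elim disjE)
      (simp_all add: reflect_def E omega_eq gamma_square gamma_cube algebra_simps add_divide_distrib
        sq sq')
  then show ?thesis by (simp add: vec_eq_iff)
qed


section \<open>Canonical heights from a canonical vector height\<close>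

lemma vector_height_invol:
  assumes "canonical_vector_height h" "P \<in> Y"
  shows "h (invol i P) = reflect i (h P)"
  using assms automorphism_invol is_pullback_invol unfolding canonical_vector_height_def by blast

lemma invol3_in_Y: "P \<in> Y \<Longrightarrow> invol3 i j k P \<in> Y"
  by (simp add: invol3_def invol_in_Y)

lemma vector_height_invol3:
  assumes "canonical_vector_height h" "P \<in> Y"
  shows "h (invol3 i j k P) = reflect i (reflect j (reflect k (h P)))"
  using assms by (simp add: invol3_def vector_height_invol invol_in_Y)

text \<open>
  Reflections are self-adjoint, so moving them to the eigenvector shows that the intersection number
  is multiplied by exactly \<open>\<omega>\<close> at each step of the orbit. The Weil height follows it within a constant, and the
  constant disappears after division by \<open>\<omega>\<^sup>n\<close>.
\<close>

lemma canonical_height_eq_intersection: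
  assumes h: "canonical_vector_height h" and P: "P \<in> Y"
    and ijk: "i \<noteq> j" "j \<noteq> k" "i \<noteq> k"
  shows "canonical_height i j k P = intersection (h P) (E_class i j k)"
proof -
  let ?E = "E_class i j k" and ?Q = "\<lambda>n. (invol3 k j i ^^ n) P"
  have Q: "?Q n \<in> Y" for n
    by (induction n) (simp_all add: P invol3_in_Y)
  have orbit: "intersection (h (?Q n)) ?E = \<omega> ^ n * intersection (h P) ?E" for n
  proof (induction n)
    case (Suc n)
    have "h (?Q (Suc n)) = reflect k (reflect j (reflect i (h (?Q n))))"
      by (simp add: vector_height_invol3[OF h Q])
    then show ?case
      using Suc by (simp add: intersection_reflect reflect_E_class[OF ijk] intersection_scale)
  qed simp
  have "weil_height ?E (h_ns ?E)"
    unfolding weil_height_def by (intro exI[of _ 0]) simp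
  then obtain C where C: "\<And>P. P \<in> Y \<Longrightarrow> \<bar>intersection (h P) ?E - h_ns ?E P\<bar> \<le> C"
    using h unfolding canonical_vector_height_def by blast
  have \<omega>: "\<omega> > 1" using gamma_gt_1 by (simp add: omega_eq)
  have "(\<lambda>n. h_ns ?E (?Q n) / \<omega> ^ n - intersection (h P) ?E) \<longlonglongrightarrow> 0"
  proof (rule Lim_null_comparison)
    show "(\<lambda>n. C / \<omega> ^ n) \<longlonglongrightarrow> 0"
      using tendsto_mult_right_zero[OF LIMSEQ_inverse_realpow_zero[OF \<omega>], of C]
      by (simp add: divide_inverse)
    show "\<forall>\<^sub>F n in sequentially. norm (h_ns ?E (?Q n) / \<omega> ^ n - intersection (h P) ?E) \<le> C / \<omega> ^ n"
    proof (intro always_eventually allI)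
      fix n
      have "h_ns ?E (?Q n) / \<omega> ^ n - intersection (h P) ?E
          = (h_ns ?E (?Q n) - intersection (h (?Q n)) ?E) / \<omega> ^ n"
        using \<omega> by (simp add: orbit field_simps)
      then show "norm (h_ns ?E (?Q n) / \<omega> ^ n - intersection (h P) ?E) \<le> C / \<omega> ^ n"
        using C[OF Q[of n]] \<omega> by (simp add: abs_minus_commute divide_right_mono)
    qed
  qed
  then have "(\<lambda>n. h_ns ?E (?Q n) / \<omega> ^ n) \<longlonglongrightarrow> intersection (h P) ?E"
    by (simp add: LIM_zero_iff)
  then show ?thesis unfolding canonical_height_def by (rule limI)
qed

text \<open>
  Up to the factor \<open>\<gamma> / 2\<close>, both differences are multiples of \<open>D 3 - D 2\<close>: exchanging the
  entries \<open>-1\<close> and \<open>\<gamma>\<^sup>2\<close> contributes \<open>\<gamma>\<^sup>2 + 1\<close>, and exchanging \<open>\<gamma>\<close> and \<open>\<gamma>\<^sup>2\<close> contributes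
  \<open>\<gamma>\<^sup>2 - \<gamma> = 1\<close>.
\<close>

lemma E_class_relation:
  "intersection A (E_class 2 1 3) - intersection A (E_class 3 1 2)
     = (\<gamma>^2 + 1) * (intersection A (E_class 1 2 3) - intersection A (E_class 1 3 2))"
proof -
  have "E_class 2 1 3 - E_class 3 1 2 = (\<gamma>^2 + 1) *\<^sub>R (E_class 1 2 3 - E_class 1 3 2)"
    by (simp add: vec_eq_iff forall_3 E_class_def D_def axis_def gamma_square algebra_simps)
  then show ?thesis
    by (metis intersection_scale intersection_diff)
qed

theorem theorem3p1:
  assumes "\<bar>canonical_height 1 2 3 P0 - 0.4746928\<bar> \<le> 0.1"
    and "\<bar>canonical_height 1 3 2 P0 - 1.0364196\<bar> \<le> 0.1"
    and "\<bar>canonical_height 2 1 3 P0 - 1.8329585\<bar> \<le> 0.1"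
    and "\<bar>canonical_height 2 3 1 P0 - 2.1332721\<bar> \<le> 0.1"
    and "\<bar>canonical_height 3 1 2 P0 - 1.8679467\<bar> \<le> 0.1"
    and "\<bar>canonical_height 3 2 1 P0 - 1.7986781\<bar> \<le> 0.1"
  shows "\<not> (\<exists>h. canonical_vector_height h)"
proof
  assume "\<exists>h. canonical_vector_height h"
  then obtain h where h: "canonical_vector_height h" ..
  let ?H = "\<lambda>i j k. canonical_height i j k P0"
  define g where "g = \<gamma>^2 + 1"
  have "?H 2 1 3 - ?H 3 1 2 = g * (?H 1 2 3 - ?H 1 3 2)"
    using canonical_height_eq_intersection[OF h P0_in_Y] E_class_relation by (simp add: g_def)
  \<comment> \<open>With the errors, the two differences are at most \<open>-0.36\<close> and at least \<open>-0.24\<close>, so a common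
    bound is available between them.\<close>
  moreover have "?H 1 2 3 - ?H 1 3 2 \<le> - 0.3"
    using assms(1,2) unfolding abs_le_iff by simp
  moreover have "?H 2 1 3 - ?H 3 1 2 \<ge> - 0.3"
    using assms(3,5) unfolding abs_le_iff by simp
  moreover have "g > 3"
    using gamma_square gamma_gt_1 by (simp add: g_def)
  ultimately show False
    using mult_mono[of 3 g "0.3" "?H 1 3 2 - ?H 1 2 3"] by (simp add: algebra_simps)
qed

end
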